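(* Let $\mathbf G=(G;\wedge,\vee,\cdot,\backslash,/,e)$ be an integral residuated lattice, let $I_1\subseteq I_0$ be sets and let $\lambda\colon I_1\to I_0$ be an injective mapping. Then the algebra $K^\lambda_{I_0,I_1}(\mathbf G):=\big(\biguplus_{n\in\mathbb N}G^{I_n};\wedge,\vee,\cdot,\backslash\!\backslash,/\!/,1\big)$ is an integral residuated lattice.
   Context: $\mathbb N=\{0,1,2,\dots\}$. A residuated lattice is an algebra $\mathbf G=(G;\wedge,\vee,\cdot,\backslash,/,e)$ such that $(G;\wedge,\vee)$ is a lattice, $(G;\cdot,e)$ is a monoid, and $x\cdot y\le z$ iff $y\le x\backslash z$ iff $x\le z/y$ for all $x,y,z\in G$. It is integral if $x\le e$ for all $x\in G$. The algebra $K^\lambda_{I_0,I_1}(\mathbf G)$. The sets may be empty. For $n\ge1$ put $I_{n+1}=\{i\in I_n: \lambda(i)\in I_n\}$. Then $\lambda^{m-n}$ is a well-defined injective map $I_m\to I_n$ for $n\le m$; $\lambda^{-m}$ denotes the inverse of the injective map $\lambda^m$ on its image. The universe is the disjoint union $\biguplus_{n\in\mathbb N}G^{I_n}$ (different $n$ always give disjoint parts, even if the sets $I_n$ coincide; if $I_n=\emptyset$, $G^{I_n}$ is a singleton). Its elements are written $\langle x_i: i\in I_n\rangle$. Order: $\langle x_i: i\in I_n\rangle\le\langle y_i: i\in I_m\rangle$ iff $m<n$, or $m=n$ and $x_i\le y_i$ for all $i\in I_n$; $\wedge,\vee$ are the lattice operations of this order. The element $1\in G^{I_0}$ has all coordinates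 equal to $e$. Product: $\langle x_i: i\in I_m\rangle\cdot\langle y_i: i\in I_n\rangle=\langle x_{\lambda^n(i)}y_i: i\in I_{m+n}\rangle$. Right division: $\langle y_i: i\in I_n\rangle/\!/\langle x_i: i\in I_m\rangle$ is $1$ if $m>n$; if $m\le n$ it is the element of $G^{I_{n-m}}$ whose $i$-th coordinate is $y_{\lambda^{-m}(i)}/x_{\lambda^{-m}(i)}$ if $i\in\lambda^m(I_n)$ and $e$ if $i\in I_{n-m}\setminus\lambda^m(I_n)$. Left division: $\langle y_i: i\in I_n\rangle\backslash\!\backslash\langle x_i: i\in I_m\rangle$ is $1$ if $n>m$; if $n\le m$ it is the element of $G^{I_{m-n}}$ whose $i$-th coordinate is $y_{\lambda^{m-n}(i)}\backslash x_i$ if $i\in I_m$ and $e$ if $i\in I_{m-n}\setminus I_m$. *)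

theory Defs
  imports "HOL-Algebra.Group" "HOL-Algebra.Lattice"
begin

record 'a residuated_lattice = "'a monoid" +
  wedge :: "'a \<Rightarrow> 'a \<Rightarrow> 'a" (infixl "\<curlywedge>\<index>" 70)
  vee :: "'a \<Rightarrow> 'a \<Rightarrow> 'a" (infixl "\<curlyvee>\<index>" 65)
  ldiv :: "'a \<Rightarrow> 'a \<Rightarrow> 'a" (infixl "\<setminus>\<index>" 70)
  rdiv :: "'a \<Rightarrow> 'a \<Rightarrow> 'a" (infixl "\<sslash>\<index>" 70)

definition wedge_le :: "('a, 'b) residuated_lattice_scheme \<Rightarrow> 'a \<Rightarrow> 'a \<Rightarrow> bool"
    (infix "\<preceq>\<index>" 50)
  where "x \<preceq>\<^bsub>G\<^esub> y \<longleftrightarrow> x \<curlywedge>\<^bsub>G\<^esub> y = x"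

locale residuated_lattice = monoid G for G (structure) +
  assumes wedge_closed: "\<lbrakk>x \<in> carrier G; y \<in> carrier G\<rbrakk> \<Longrightarrow> x \<curlywedge> y \<in> carrier G"
    and vee_closed: "\<lbrakk>x \<in> carrier G; y \<in> carrier G\<rbrakk> \<Longrightarrow> x \<curlyvee> y \<in> carrier G"
    and wedge_comm: "\<lbrakk>x \<in> carrier G; y \<in> carrier G\<rbrakk> \<Longrightarrow> x \<curlywedge> y = y \<curlywedge> x"
    and vee_comm: "\<lbrakk>x \<in> carrier G; y \<in> carrier G\<rbrakk> \<Longrightarrow> x \<curlyvee> y = y \<curlyvee> x"
    and wedge_assoc: "\<lbrakk>x \<in> carrier G; y \<in> carrier G; z \<in> carrier G\<rbrakk> \<Longrightarrow>
      (x \<curlywedge> y) \<curlywedge> z = x \<curlywedge> (y \<curlywedge> z)"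
    and vee_assoc: "\<lbrakk>x \<in> carrier G; y \<in> carrier G; z \<in> carrier G\<rbrakk> \<Longrightarrow>
      (x \<curlyvee> y) \<curlyvee> z = x \<curlyvee> (y \<curlyvee> z)"
    and wedge_absorb: "\<lbrakk>x \<in> carrier G; y \<in> carrier G\<rbrakk> \<Longrightarrow> x \<curlywedge> (x \<curlyvee> y) = x"
    and vee_absorb: "\<lbrakk>x \<in> carrier G; y \<in> carrier G\<rbrakk> \<Longrightarrow> x \<curlyvee> (x \<curlywedge> y) = x"
    and ldiv_closed: "\<lbrakk>x \<in> carrier G; y \<in> carrier G\<rbrakk> \<Longrightarrow> x \<setminus> y \<in> carrier G"
    and rdiv_closed: "\<lbrakk>x \<in> carrier G; y \<in> carrier G\<rbrakk> \<Longrightarrow> x \<sslash> y \<in> carrier G"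
    and ldiv_residuated: "\<lbrakk>x \<in> carrier G; y \<in> carrier G; z \<in> carrier G\<rbrakk> \<Longrightarrow>
      x \<otimes> y \<preceq> z \<longleftrightarrow> y \<preceq> x \<setminus> z"
    and rdiv_residuated: "\<lbrakk>x \<in> carrier G; y \<in> carrier G; z \<in> carrier G\<rbrakk> \<Longrightarrow>
      x \<otimes> y \<preceq> z \<longleftrightarrow> x \<preceq> z \<sslash> y"

locale integral_residuated_lattice = residuated_lattice +
  assumes integral: "x \<in> carrier G \<Longrightarrow> x \<preceq> \<one>"

fun K_index :: "'i set \<Rightarrow> 'i set \<Rightarrow> ('i \<Rightarrow> 'i) \<Rightarrow> nat \<Rightarrow> 'i set" where
  "K_index I0 I1 lam 0 = I0"
| "K_index I0 I1 lam (Suc 0) = I1"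
| "K_index I0 I1 lam (Suc (Suc n)) =
    {i \<in> K_index I0 I1 lam (Suc n). lam i \<in> K_index I0 I1 lam (Suc n)}"

text \<open>
  The disjoint union is a set of pairs of a level \<open>n\<close> and a family in \<open>G\<^sup>I\<close> for the \<open>n\<close>-th index
  set \<open>I\<close>; families are extensional functions, so the level over an empty index set is a singleton.
\<close>
definition K_carrier ::
    "('a, 'b) residuated_lattice_scheme \<Rightarrow> 'i set \<Rightarrow> 'i set \<Rightarrow> ('i \<Rightarrow> 'i) \<Rightarrow> (nat \<times> ('i \<Rightarrow> 'a)) set"
  where "K_carrier G I0 I1 lam = (SIGMA n : UNIV. K_index I0 I1 lam n \<rightarrow>\<^sub>E carrier G)"

definition K_le ::
    "('a, 'b) residuated_lattice_scheme \<Rightarrow> 'i set \<Rightarrow> 'i set \<Rightarrow> ('i \<Rightarrow> 'i) \<Rightarrow>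
      nat \<times> ('i \<Rightarrow> 'a) \<Rightarrow> nat \<times> ('i \<Rightarrow> 'a) \<Rightarrow> bool"
  where "K_le G I0 I1 lam = (\<lambda>(n, x) (m, y).
    m < n \<or> (m = n \<and> (\<forall>i \<in> K_index I0 I1 lam n. x i \<preceq>\<^bsub>G\<^esub> y i)))"

definition K_order ::
    "('a, 'b) residuated_lattice_scheme \<Rightarrow> 'i set \<Rightarrow> 'i set \<Rightarrow> ('i \<Rightarrow> 'i) \<Rightarrow>
      (nat \<times> ('i \<Rightarrow> 'a)) gorder"
  where "K_order G I0 I1 lam =
    \<lparr>carrier = K_carrier G I0 I1 lam, eq = (=), le = K_le G I0 I1 lam\<rparr>"

definition K_one ::
    "('a, 'b) residuated_lattice_scheme \<Rightarrow> 'i set \<Rightarrow> nat \<times> ('i \<Rightarrow> 'a)"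
  where "K_one G I0 = (0, \<lambda>i \<in> I0. \<one>\<^bsub>G\<^esub>)"

definition K_mult ::
    "('a, 'b) residuated_lattice_scheme \<Rightarrow> 'i set \<Rightarrow> 'i set \<Rightarrow> ('i \<Rightarrow> 'i) \<Rightarrow>
      nat \<times> ('i \<Rightarrow> 'a) \<Rightarrow> nat \<times> ('i \<Rightarrow> 'a) \<Rightarrow> nat \<times> ('i \<Rightarrow> 'a)"
  where "K_mult G I0 I1 lam = (\<lambda>(m, x) (n, y).
    (m + n, \<lambda>i \<in> K_index I0 I1 lam (m + n). x ((lam ^^ n) i) \<otimes>\<^bsub>G\<^esub> y i))"

text \<open>
  \<open>K_lam_inv I0 I1 lam m\<close> inverts the \<open>m\<close>-th power of \<open>lam\<close> on the \<open>m\<close>-th index set, the domain of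
  that power.
\<close>
definition K_lam_inv :: "'i set \<Rightarrow> 'i set \<Rightarrow> ('i \<Rightarrow> 'i) \<Rightarrow> nat \<Rightarrow> 'i \<Rightarrow> 'i"
  where "K_lam_inv I0 I1 lam m = inv_into (K_index I0 I1 lam m) (lam ^^ m)"

definition K_rdiv ::
    "('a, 'b) residuated_lattice_scheme \<Rightarrow> 'i set \<Rightarrow> 'i set \<Rightarrow> ('i \<Rightarrow> 'i) \<Rightarrow>
      nat \<times> ('i \<Rightarrow> 'a) \<Rightarrow> nat \<times> ('i \<Rightarrow> 'a) \<Rightarrow> nat \<times> ('i \<Rightarrow> 'a)"
  where "K_rdiv G I0 I1 lam = (\<lambda>(n, y) (m, x).
    if m > n then K_one G I0
    else (n - m, \<lambda>i \<in> K_index I0 I1 lam (n - m).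
      if i \<in> (lam ^^ m) ` K_index I0 I1 lam n
      then y (K_lam_inv I0 I1 lam m i) \<sslash>\<^bsub>G\<^esub> x (K_lam_inv I0 I1 lam m i)
      else \<one>\<^bsub>G\<^esub>))"

definition K_ldiv ::
    "('a, 'b) residuated_lattice_scheme \<Rightarrow> 'i set \<Rightarrow> 'i set \<Rightarrow> ('i \<Rightarrow> 'i) \<Rightarrow>
      nat \<times> ('i \<Rightarrow> 'a) \<Rightarrow> nat \<times> ('i \<Rightarrow> 'a) \<Rightarrow> nat \<times> ('i \<Rightarrow> 'a)"
  where "K_ldiv G I0 I1 lam = (\<lambda>(n, y) (m, x).
    if n > m then K_one G I0
    else (m - n, \<lambda>i \<in> K_index I0 I1 lam (m - n).
      if i \<in> K_index I0 I1 lam m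
      then y ((lam ^^ (m - n)) i) \<setminus>\<^bsub>G\<^esub> x i
      else \<one>\<^bsub>G\<^esub>))"

definition K_algebra ::
    "('a, 'b) residuated_lattice_scheme \<Rightarrow> 'i set \<Rightarrow> 'i set \<Rightarrow> ('i \<Rightarrow> 'i) \<Rightarrow>
      (nat \<times> ('i \<Rightarrow> 'a)) residuated_lattice"
  where "K_algebra G I0 I1 lam =
    \<lparr>carrier = K_carrier G I0 I1 lam,
     monoid.mult = K_mult G I0 I1 lam,
     one = K_one G I0,
     wedge = Lattice.meet (K_order G I0 I1 lam),
     vee = Lattice.join (K_order G I0 I1 lam),
     ldiv = K_ldiv G I0 I1 lam,
     rdiv = K_rdiv G I0 I1 lam\<rparr>"

end

theory Submission
  imports Defs
begin

text \<open>
  As an ordered set, the construction is an ordinal sum of the powers of \<open>G\<close> over the index sets,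
  stacked downwards: raising the level of a family makes it smaller. The product adds levels and the unit
  sits at the top of level \<open>0\<close>, so an inequality \<open>X \<cdot> Y \<le> Z\<close> between families of levels \<open>m\<close>,
  \<open>n\<close>, \<open>k\<close> is decided by the levels alone, except when \<open>m + n = k\<close>. In that one case it says
  \<open>x\<^bsub>\<lambda>\<^sup>n(i)\<^esub> y\<^sub>i \<le> z\<^sub>i\<close> for all \<open>i\<close> in the \<open>k\<close>-th index set, and residuation in \<open>G\<close> turns this into
  a condition on \<open>y\<^sub>i\<close>, or on \<open>x\<^sub>j\<close> with \<open>j = \<lambda>\<^sup>n(i)\<close>. The condition constrains only some of the
  coordinates of \<open>Y\<close> or of \<open>X\<close>; the divisions put the top element \<open>e\<close> at all the others, and
  integrality makes the inequality there hold automatically.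

  Two facts about the index sets carry the bookkeeping. An index lies in the set of level \<open>m + n\<close>
  exactly if it lies in the set of level \<open>n\<close> and its image under \<open>\<lambda>\<^sup>n\<close> lies in the set of level
  \<open>m\<close> (\<open>K_index_add\<close>); this makes the product well defined and associative. And \<open>\<lambda>\<^sup>n\<close> is injective
  on the set of level \<open>n\<close> (\<open>inj_on_lam_pow\<close>), so that each coordinate of \<open>X\<close> is constrained by at
  most one \<open>i\<close>, which is what right division needs.
\<close>

section \<open>The order of a residuated lattice\<close>

context residuated_lattice
begin

lemma wedge_idem: "x \<in> carrier G \<Longrightarrow> x \<curlywedge> x = x"
  by (metis vee_absorb wedge_absorb wedge_closed)

lemma wedge_le_refl: "x \<in> carrier G \<Longrightarrow> x \<preceq> x"
  by (simp add: wedge_le_def wedge_idem)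

lemma wedge_le_antisym:
  "\<lbrakk>x \<preceq> y; y \<preceq> x; x \<in> carrier G; y \<in> carrier G\<rbrakk> \<Longrightarrow> x = y"
  by (metis wedge_comm wedge_le_def)

lemma wedge_le_trans:
  "\<lbrakk>x \<preceq> y; y \<preceq> z; x \<in> carrier G; y \<in> carrier G; z \<in> carrier G\<rbrakk> \<Longrightarrow> x \<preceq> z"
  by (metis wedge_assoc wedge_le_def)

lemma wedge_le_iff_vee:
  "\<lbrakk>x \<in> carrier G; y \<in> carrier G\<rbrakk> \<Longrightarrow> x \<preceq> y \<longleftrightarrow> x \<curlyvee> y = y"
  by (metis vee_absorb vee_comm wedge_absorb wedge_comm wedge_le_def)

lemma wedge_lower1: "\<lbrakk>x \<in> carrier G; y \<in> carrier G\<rbrakk> \<Longrightarrow> x \<curlywedge> y \<preceq> x"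
  by (metis wedge_assoc wedge_closed wedge_comm wedge_idem wedge_le_def)

lemma wedge_lower2: "\<lbrakk>x \<in> carrier G; y \<in> carrier G\<rbrakk> \<Longrightarrow> x \<curlywedge> y \<preceq> y"
  by (metis wedge_comm wedge_lower1)

lemma wedge_greatest:
  "\<lbrakk>z \<preceq> x; z \<preceq> y; x \<in> carrier G; y \<in> carrier G; z \<in> carrier G\<rbrakk> \<Longrightarrow> z \<preceq> x \<curlywedge> y"
  by (metis wedge_assoc wedge_le_def)

lemma vee_upper1: "\<lbrakk>x \<in> carrier G; y \<in> carrier G\<rbrakk> \<Longrightarrow> x \<preceq> x \<curlyvee> y"
  by (simp add: wedge_absorb wedge_le_def)

lemma vee_upper2: "\<lbrakk>x \<in> carrier G; y \<in> carrier G\<rbrakk> \<Longrightarrow> y \<preceq> x \<curlyvee> y"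
  by (metis vee_comm vee_upper1)

lemma vee_least:
  "\<lbrakk>x \<preceq> z; y \<preceq> z; x \<in> carrier G; y \<in> carrier G; z \<in> carrier G\<rbrakk> \<Longrightarrow> x \<curlyvee> y \<preceq> z"
  by (metis vee_assoc vee_closed wedge_le_iff_vee)

end

section \<open>Suprema and infima in ordered carriers\<close>

lemma (in weak_partial_order) least_Upper_comparable:
  "\<lbrakk>x \<sqsubseteq> y; x \<in> carrier L; y \<in> carrier L\<rbrakk> \<Longrightarrow> least L y (Upper L {x, y})"
  by (rule least_UpperI) auto

lemma (in weak_partial_order) greatest_Lower_comparable:
  "\<lbrakk>x \<sqsubseteq> y; x \<in> carrier L; y \<in> carrier L\<rbrakk> \<Longrightarrow> greatest L x (Lower L {x, y})"
  by (rule greatest_LowerI) auto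

lemma (in lattice) meet_join_absorb:
  "\<lbrakk>x \<in> carrier L; y \<in> carrier L\<rbrakk> \<Longrightarrow> x \<sqinter> (x \<squnion> y) = x"
  by (metis join_closed join_left le_iff_join)

lemma (in lattice) join_meet_absorb:
  "\<lbrakk>x \<in> carrier L; y \<in> carrier L\<rbrakk> \<Longrightarrow> x \<squnion> (x \<sqinter> y) = x"
  by (metis Lattice.join_comm le_iff_meet meet_closed meet_left)

section \<open>The index sets\<close>

locale K_construction = integral_residuated_lattice G for G (structure) +
  fixes I0 I1 :: "'i set" and lam :: "'i \<Rightarrow> 'i"
  assumes I1_subset: "I1 \<subseteq> I0"
    and lam_funcset: "lam \<in> I1 \<rightarrow> I0"
    and inj_on_lam: "inj_on lam I1"
begin

abbreviation I :: "nat \<Rightarrow> 'i set" where "I \<equiv> K_index I0 I1 lam"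
abbreviation K where "K \<equiv> K_algebra G I0 I1 lam"
abbreviation L where "L \<equiv> K_order G I0 I1 lam"

lemma K_index_Suc_subset: "I (Suc n) \<subseteq> I n"
  using I1_subset by (cases n) auto

lemma K_index_subset_I0: "I n \<subseteq> I0"
  using K_index_Suc_subset by (induction n) auto

text \<open>
  The recursion defining the index sets asks for \<open>i\<close> itself to lie in the preceding set. Inductively,
  \<open>i \<in> I1\<close> is enough: \<open>\<lambda>(i)\<close> then lies one set further back as well, because the sets decrease,
  and that puts \<open>i\<close> into the preceding set.
\<close>
lemma K_index_Suc: "I (Suc n) = {i \<in> I1. lam i \<in> I n}"
proof (induction n)
  case 0
  then show ?case using lam_funcset by auto
next
  case (Suc n)
  have "I (Suc (Suc n)) = {i \<in> I (Suc n). lam i \<in> I (Suc n)}" by simp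
  also have "\<dots> = {i \<in> I1. lam i \<in> I (Suc n)}"
    using Suc.IH K_index_Suc_subset[of n] by blast
  finally show ?case .
qed

text \<open>
  Both sides say that the first \<open>m + n\<close> iterates of \<open>\<lambda>\<close> starting from \<open>i\<close> are defined; the right
  side splits this orbit after \<open>n\<close> steps.
\<close>
lemma K_index_add: "i \<in> I (m + n) \<longleftrightarrow> i \<in> I n \<and> (lam ^^ n) i \<in> I m"
proof (induction n arbitrary: i)
  case 0
  then show ?case using K_index_subset_I0[of m] by auto
next
  case (Suc n)
  then show ?case
    by (simp add: K_index_Suc funpow_swap1 del: K_index.simps)
qed

lemma inj_on_lam_pow: "inj_on (lam ^^ n) (I n)"
proof (induction n)
  case 0
  then show ?case by simp
next
  case (Suc n)
  have "inj_on lam (I (Suc n))"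
    by (rule inj_on_subset[OF inj_on_lam]) (auto simp: K_index_Suc simp del: K_index.simps)
  moreover have "inj_on (lam ^^ n) (lam ` I (Suc n))"
    by (rule inj_on_subset[OF Suc.IH]) (auto simp: K_index_Suc simp del: K_index.simps)
  ultimately show ?case
    by (simp only: funpow_Suc_right comp_inj_on)
qed

lemma K_lam_inv_lam_pow: "i \<in> I n \<Longrightarrow> K_lam_inv I0 I1 lam n ((lam ^^ n) i) = i"
  by (simp add: K_lam_inv_def inv_into_f_f[OF inj_on_lam_pow])

section \<open>The lattice\<close>

lemma family_closed: "\<lbrakk>x \<in> A \<rightarrow>\<^sub>E carrier G; i \<in> A\<rbrakk> \<Longrightarrow> x i \<in> carrier G"
  by auto

lemma K_carrier_iff: "(n, x) \<in> carrier K \<longleftrightarrow> x \<in> I n \<rightarrow>\<^sub>E carrier G"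
  by (simp add: K_algebra_def K_carrier_def)

lemma K_carrier_cases:
  assumes "X \<in> carrier K"
  obtains n x where "X = (n, x)" and "x \<in> I n \<rightarrow>\<^sub>E carrier G"
  using assms by (cases X) (auto simp: K_carrier_iff)

lemma K_le_iff:
  "K_le G I0 I1 lam (n, x) (m, y) \<longleftrightarrow> m < n \<or> m = n \<and> (\<forall>i\<in>I n. x i \<preceq> y i)"
  by (simp add: K_le_def)

lemma K_order_simps [simp]:
  "carrier L = carrier K" "le L = K_le G I0 I1 lam" "eq L = (=)"
  by (simp_all add: K_order_def K_algebra_def)

lemma partial_order_K_order: "partial_order L"
proof
  fix X Y assume "X \<in> carrier L" "Y \<in> carrier L"
    and le: "le L X Y" "le L Y X"
  then obtain n x m y where X: "X = (n, x)" "x \<in> I n \<rightarrow>\<^sub>E carrier G"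
    and Y: "Y = (m, y)" "y \<in> I m \<rightarrow>\<^sub>E carrier G"
    by (metis K_carrier_cases K_order_simps(1))
  then have "n = m" using le by (auto simp: K_le_iff)
  moreover have "x = y"
    using X Y le \<open>n = m\<close>
    by (intro PiE_ext[of x "I n" _ y] wedge_le_antisym) (auto simp: K_le_iff family_closed)
  ultimately show "eq L X Y" using X Y by simp
next
  fix X Y Z assume "X \<in> carrier L" "Y \<in> carrier L" "Z \<in> carrier L"
    and "le L X Y" "le L Y Z"
  then show "le L X Z"
    by (auto simp: K_le_iff elim!: K_carrier_cases; meson PiE_mem wedge_le_trans)
qed (auto simp: K_le_iff elim!: K_carrier_cases intro!: wedge_le_refl)

lemma K_join_exists:
  assumes "X \<in> carrier K" "Y \<in> carrier K"
  shows "\<exists>S. least L S (Upper L {X, Y})"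
proof -
  interpret partial_order L by (rule partial_order_K_order)
  obtain n x where X: "X = (n, x)" "x \<in> I n \<rightarrow>\<^sub>E carrier G" using assms(1) by (rule K_carrier_cases)
  obtain m y where Y: "Y = (m, y)" "y \<in> I m \<rightarrow>\<^sub>E carrier G" using assms(2) by (rule K_carrier_cases)
  consider "K_le G I0 I1 lam X Y" | "K_le G I0 I1 lam Y X" | "n = m"
    using X Y by (metis K_le_iff linorder_neqE_nat)
  then show ?thesis
  proof cases
    case 1
    then have "least L Y (Upper L {X, Y})"
      using assms by (intro least_Upper_comparable) simp_all
    then show ?thesis ..
  next
    case 2
    then have "least L X (Upper L {Y, X})"
      using assms by (intro least_Upper_comparable) simp_all
    then show ?thesis by (subst insert_commute) (rule exI)
  next
    case 3
    let ?s = "\<lambda>i\<in>I n. x i \<curlyvee> y i"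
    have s: "?s \<in> I n \<rightarrow>\<^sub>E carrier G"
      using X Y 3 by (auto intro!: vee_closed)
    have "least L (n, ?s) (Upper L {X, Y})"
    proof (rule least_UpperI)
      show "le L Z (n, ?s)" if "Z \<in> {X, Y}" for Z
        using that X Y 3 by (auto simp: K_le_iff family_closed vee_upper1 vee_upper2)
      show "le L (n, ?s) Z" if "Z \<in> Upper L {X, Y}" for Z
      proof -
        have "Z \<in> carrier K" "K_le G I0 I1 lam X Z" "K_le G I0 I1 lam Y Z"
          using that assms by (auto simp: Upper_def simp del: split_paired_All)
        then show ?thesis
          using X Y 3 by (auto simp: K_le_iff family_closed elim!: K_carrier_cases intro!: vee_least)
      qed
    qed (use assms s in \<open>auto simp: K_carrier_iff\<close>)
    then show ?thesis ..
  qed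
qed

lemma K_meet_exists:
  assumes "X \<in> carrier K" "Y \<in> carrier K"
  shows "\<exists>S. greatest L S (Lower L {X, Y})"
proof -
  interpret partial_order L by (rule partial_order_K_order)
  obtain n x where X: "X = (n, x)" "x \<in> I n \<rightarrow>\<^sub>E carrier G" using assms(1) by (rule K_carrier_cases)
  obtain m y where Y: "Y = (m, y)" "y \<in> I m \<rightarrow>\<^sub>E carrier G" using assms(2) by (rule K_carrier_cases)
  consider "K_le G I0 I1 lam X Y" | "K_le G I0 I1 lam Y X" | "n = m"
    using X Y by (metis K_le_iff linorder_neqE_nat)
  then show ?thesis
  proof cases
    case 1
    then have "greatest L X (Lower L {X, Y})"
      using assms by (intro greatest_Lower_comparable) simp_all
    then show ?thesis ..
  next
    case 2
    then have "greatest L Y (Lower L {Y, X})"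
      using assms by (intro greatest_Lower_comparable) simp_all
    then show ?thesis by (subst insert_commute) (rule exI)
  next
    case 3
    let ?s = "\<lambda>i\<in>I n. x i \<curlywedge> y i"
    have s: "?s \<in> I n \<rightarrow>\<^sub>E carrier G"
      using X Y 3 by (auto intro!: wedge_closed)
    have "greatest L (n, ?s) (Lower L {X, Y})"
    proof (rule greatest_LowerI)
      show "le L (n, ?s) Z" if "Z \<in> {X, Y}" for Z
        using that X Y 3 by (auto simp: K_le_iff family_closed wedge_lower1 wedge_lower2)
      show "le L Z (n, ?s)" if "Z \<in> Lower L {X, Y}" for Z
      proof -
        have "Z \<in> carrier K" "K_le G I0 I1 lam Z X" "K_le G I0 I1 lam Z Y"
          using that assms by (auto simp: Lower_def simp del: split_paired_All)
        then show ?thesis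
          using X Y 3 by (auto simp: K_le_iff family_closed elim!: K_carrier_cases intro!: wedge_greatest)
      qed
    qed (use assms s in \<open>auto simp: K_carrier_iff\<close>)
    then show ?thesis ..
  qed
qed

lemma lattice_K_order: "lattice L"
proof -
  interpret partial_order L by (rule partial_order_K_order)
  show ?thesis by unfold_locales (simp_all only: K_order_simps K_join_exists K_meet_exists)
qed

lemma K_wedge_le_iff:
  assumes "X \<in> carrier K" "Y \<in> carrier K"
  shows "X \<preceq>\<^bsub>K\<^esub> Y \<longleftrightarrow> K_le G I0 I1 lam X Y"
proof -
  interpret lattice L by (rule lattice_K_order)
  show ?thesis using le_iff_join[of X Y] assms
    by (auto simp: wedge_le_def K_algebra_def)
qed

section \<open>The monoid\<close>

lemma K_mult_eq:
  "(m, x) \<otimes>\<^bsub>K\<^esub> (n, y) = (m + n, \<lambda>i\<in>I (m + n). x ((lam ^^ n) i) \<otimes> y i)"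
  by (simp add: K_algebra_def K_mult_def)

lemma K_one_eq: "\<one>\<^bsub>K\<^esub> = (0, \<lambda>i\<in>I 0. \<one>)"
  by (simp add: K_algebra_def K_one_def)

lemma K_one_closed: "\<one>\<^bsub>K\<^esub> \<in> carrier K"
  unfolding K_one_eq K_carrier_iff by auto

lemma K_mult_closed:
  assumes "X \<in> carrier K" "Y \<in> carrier K"
  shows "X \<otimes>\<^bsub>K\<^esub> Y \<in> carrier K"
proof -
  obtain m x where X: "X = (m, x)" "x \<in> I m \<rightarrow>\<^sub>E carrier G" using assms(1) by (rule K_carrier_cases)
  obtain n y where Y: "Y = (n, y)" "y \<in> I n \<rightarrow>\<^sub>E carrier G" using assms(2) by (rule K_carrier_cases)
  show ?thesis using X Y
    by (auto simp: K_mult_eq K_carrier_iff K_index_add family_closed)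
qed

lemma monoid_K: "monoid K"
proof
  fix X Y Z assume "X \<in> carrier K" "Y \<in> carrier K" "Z \<in> carrier K"
  then obtain l x m y n z where X: "X = (l, x)" "x \<in> I l \<rightarrow>\<^sub>E carrier G"
    and Y: "Y = (m, y)" "y \<in> I m \<rightarrow>\<^sub>E carrier G" and Z: "Z = (n, z)" "z \<in> I n \<rightarrow>\<^sub>E carrier G"
    by (metis K_carrier_cases)
  have "x ((lam ^^ m) ((lam ^^ n) i)) \<otimes> y ((lam ^^ n) i) \<otimes> z i =
      x ((lam ^^ (m + n)) i) \<otimes> (y ((lam ^^ n) i) \<otimes> z i)"
    if "i \<in> I (l + m + n)" for i
  proof -
    have "i \<in> I n" "(lam ^^ n) i \<in> I m" "(lam ^^ m) ((lam ^^ n) i) \<in> I l"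
      using that by (simp_all add: K_index_add)
    moreover have "(lam ^^ m) ((lam ^^ n) i) = (lam ^^ (m + n)) i"
      by (simp add: funpow_add)
    ultimately show ?thesis using X Y Z by (simp add: m_assoc family_closed)
  qed
  then show "X \<otimes>\<^bsub>K\<^esub> Y \<otimes>\<^bsub>K\<^esub> Z = X \<otimes>\<^bsub>K\<^esub> (Y \<otimes>\<^bsub>K\<^esub> Z)"
    using X Y Z by (auto simp: K_mult_eq add.assoc K_index_add[of _ l m] K_index_add[of _ "l + m" n]
        K_index_add[of _ m n] K_index_add[of _ l "m + n"] funpow_add intro!: restrict_ext)
next
  fix X assume "X \<in> carrier K"
  then obtain n x where X: "X = (n, x)" "x \<in> I n \<rightarrow>\<^sub>E carrier G" by (rule K_carrier_cases)
  have "(lam ^^ n) i \<in> I 0" if "i \<in> I n" for i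
    using that K_index_add[of i 0 n] by simp
  then have "(\<lambda>i\<in>I n. (\<lambda>i\<in>I 0. \<one>) ((lam ^^ n) i) \<otimes> x i) = (\<lambda>i\<in>I n. x i)"
    using X by (intro restrict_ext) (simp add: family_closed del: K_index.simps)
  then show "\<one>\<^bsub>K\<^esub> \<otimes>\<^bsub>K\<^esub> X = X"
    using X by (simp add: K_one_eq K_mult_eq PiE_restrict del: K_index.simps)
  have "(\<lambda>i\<in>I n. x i \<otimes> (\<lambda>i\<in>I 0. \<one>) i) = (\<lambda>i\<in>I n. x i)"
    using X K_index_subset_I0[of n] by (intro restrict_ext) (auto simp: family_closed)
  then show "X \<otimes>\<^bsub>K\<^esub> \<one>\<^bsub>K\<^esub> = X"
    using X by (simp add: K_one_eq K_mult_eq PiE_restrict del: K_index.simps)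
qed (simp_all add: K_mult_closed K_one_closed)

section \<open>Residuation and integrality\<close>

lemma K_integral: "X \<in> carrier K \<Longrightarrow> X \<preceq>\<^bsub>K\<^esub> \<one>\<^bsub>K\<^esub>"
  by (subst K_wedge_le_iff[OF _ K_one_closed])
    (auto simp: K_one_eq K_le_iff family_closed simp del: K_index.simps elim!: K_carrier_cases
      intro!: integral)

lemma K_ldiv_eq:
  "(m, x) \<setminus>\<^bsub>K\<^esub> (k, z) = (if k < m then \<one>\<^bsub>K\<^esub>
    else (k - m, \<lambda>i\<in>I (k - m). if i \<in> I k then x ((lam ^^ (k - m)) i) \<setminus> z i else \<one>))"
  by (simp add: K_algebra_def K_ldiv_def)

lemma K_rdiv_eq:
  "(k, z) \<sslash>\<^bsub>K\<^esub> (n, y) = (if k < n then \<one>\<^bsub>K\<^esub>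
    else (k - n, \<lambda>j\<in>I (k - n). if j \<in> (lam ^^ n) ` I k
      then z (K_lam_inv I0 I1 lam n j) \<sslash> y (K_lam_inv I0 I1 lam n j) else \<one>))"
  by (simp add: K_algebra_def K_rdiv_def)

lemma K_ldiv_closed:
  assumes "X \<in> carrier K" "Z \<in> carrier K"
  shows "X \<setminus>\<^bsub>K\<^esub> Z \<in> carrier K"
proof -
  obtain m x where X: "X = (m, x)" "x \<in> I m \<rightarrow>\<^sub>E carrier G" using assms(1) by (rule K_carrier_cases)
  obtain k z where Z: "Z = (k, z)" "z \<in> I k \<rightarrow>\<^sub>E carrier G" using assms(2) by (rule K_carrier_cases)
  have "(lam ^^ (k - m)) i \<in> I m" if "i \<in> I k" "m \<le> k" for i
    using that K_index_add[of i m "k - m"] by simp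
  then show ?thesis using X Z
    by (auto simp: K_ldiv_eq K_one_closed K_carrier_iff family_closed intro!: ldiv_closed)
qed

lemma K_rdiv_closed:
  assumes "Z \<in> carrier K" "Y \<in> carrier K"
  shows "Z \<sslash>\<^bsub>K\<^esub> Y \<in> carrier K"
proof -
  obtain k z where Z: "Z = (k, z)" "z \<in> I k \<rightarrow>\<^sub>E carrier G" using assms(1) by (rule K_carrier_cases)
  obtain n y where Y: "Y = (n, y)" "y \<in> I n \<rightarrow>\<^sub>E carrier G" using assms(2) by (rule K_carrier_cases)
  have "i \<in> I n" if "i \<in> I k" "n \<le> k" for i
    using that K_index_add[of i "k - n" n] by simp
  then show ?thesis using Y Z
    by (auto simp: K_rdiv_eq K_one_closed K_carrier_iff family_closed K_lam_inv_lam_pow intro!: rdiv_closed)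
qed

text \<open>
  Let \<open>X\<close>, \<open>Y\<close>, \<open>Z\<close> have levels \<open>m\<close>, \<open>n\<close>, \<open>k\<close>. If \<open>m > k\<close>, the left side holds because the product
  lies strictly below level \<open>k\<close>, and the right side because the quotient is the unit, which is the
  top element. If \<open>m \<le> k\<close> and \<open>m + n \<noteq> k\<close>, both sides are decided by the same comparison of levels.
  On the critical level \<open>m + n = k\<close>, the coordinates of \<open>Y\<close> outside the \<open>k\<close>-th index set meet no
  condition on the left, and the condition \<open>y\<^sub>i \<le> e\<close> on the right, which integrality of \<open>G\<close> supplies.
\<close>
lemma K_ldiv_residuated:
  assumes "X \<in> carrier K" "Y \<in> carrier K" "Z \<in> carrier K"
  shows "X \<otimes>\<^bsub>K\<^esub> Y \<preceq>\<^bsub>K\<^esub> Z \<longleftrightarrow> Y \<preceq>\<^bsub>K\<^esub> X \<setminus>\<^bsub>K\<^esub> Z"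
proof -
  obtain m x where X: "X = (m, x)" "x \<in> I m \<rightarrow>\<^sub>E carrier G" using assms(1) by (rule K_carrier_cases)
  obtain n y where Y: "Y = (n, y)" "y \<in> I n \<rightarrow>\<^sub>E carrier G" using assms(2) by (rule K_carrier_cases)
  obtain k z where Z: "Z = (k, z)" "z \<in> I k \<rightarrow>\<^sub>E carrier G" using assms(3) by (rule K_carrier_cases)
  have le: "X \<otimes>\<^bsub>K\<^esub> Y \<preceq>\<^bsub>K\<^esub> Z \<longleftrightarrow> K_le G I0 I1 lam (X \<otimes>\<^bsub>K\<^esub> Y) Z"
    "Y \<preceq>\<^bsub>K\<^esub> X \<setminus>\<^bsub>K\<^esub> Z \<longleftrightarrow> K_le G I0 I1 lam Y (X \<setminus>\<^bsub>K\<^esub> Z)"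
    using assms by (simp_all add: K_wedge_le_iff K_mult_closed K_ldiv_closed)
  consider "k < m" | "m \<le> k" "m + n \<noteq> k" | "m + n = k" by linarith
  then show ?thesis
  proof cases
    case 1
    have "Y \<preceq>\<^bsub>K\<^esub> \<one>\<^bsub>K\<^esub>" using K_integral assms(2) .
    with 1 show ?thesis unfolding X Y Z le(1)[unfolded X Y Z]
      by (simp add: K_ldiv_eq K_mult_eq K_le_iff)
  next
    case 2
    then show ?thesis unfolding le unfolding X Y Z
      by (auto simp: K_ldiv_eq K_mult_eq K_le_iff)
  next
    case 3
    have "x ((lam ^^ n) i) \<otimes> y i \<preceq> z i \<longleftrightarrow> y i \<preceq> x ((lam ^^ n) i) \<setminus> z i" if "i \<in> I k" for i
      using that X Y Z 3 K_index_add[of i m n] by (intro ldiv_residuated) (auto simp: family_closed)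
    moreover have "i \<in> I n" if "i \<in> I k" for i
      using that 3 K_index_add[of i m n] by simp
    moreover have "y i \<preceq> \<one>" if "i \<in> I n" for i
      using that Y by (intro integral) (auto simp: family_closed)
    ultimately show ?thesis unfolding le unfolding X Y Z
      using 3 by (auto simp: K_ldiv_eq K_mult_eq K_le_iff)
  qed
qed

text \<open>
  Let \<open>X\<close>, \<open>Y\<close>, \<open>Z\<close> have levels \<open>m\<close>, \<open>n\<close>, \<open>k\<close>. Off the critical level \<open>m + n = k\<close>, this is decided
  as for left division. On it, the coordinates of \<open>X\<close> that the product sees are those indexed by the
  image of the \<open>k\<close>-th index set under \<open>\<lambda>\<^sup>n\<close>. Injectivity of \<open>\<lambda>\<^sup>n\<close> lets them be reindexed by that set; at the remaining coordinates the quotient is \<open>e\<close>, which bounds \<open>X\<close> there.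
\<close>
lemma K_rdiv_residuated:
  assumes "X \<in> carrier K" "Y \<in> carrier K" "Z \<in> carrier K"
  shows "X \<otimes>\<^bsub>K\<^esub> Y \<preceq>\<^bsub>K\<^esub> Z \<longleftrightarrow> X \<preceq>\<^bsub>K\<^esub> Z \<sslash>\<^bsub>K\<^esub> Y"
proof -
  obtain m x where X: "X = (m, x)" "x \<in> I m \<rightarrow>\<^sub>E carrier G" using assms(1) by (rule K_carrier_cases)
  obtain n y where Y: "Y = (n, y)" "y \<in> I n \<rightarrow>\<^sub>E carrier G" using assms(2) by (rule K_carrier_cases)
  obtain k z where Z: "Z = (k, z)" "z \<in> I k \<rightarrow>\<^sub>E carrier G" using assms(3) by (rule K_carrier_cases)
  have le: "X \<otimes>\<^bsub>K\<^esub> Y \<preceq>\<^bsub>K\<^esub> Z \<longleftrightarrow> K_le G I0 I1 lam (X \<otimes>\<^bsub>K\<^esub> Y) Z"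
    "X \<preceq>\<^bsub>K\<^esub> Z \<sslash>\<^bsub>K\<^esub> Y \<longleftrightarrow> K_le G I0 I1 lam X (Z \<sslash>\<^bsub>K\<^esub> Y)"
    using assms by (simp_all add: K_wedge_le_iff K_mult_closed K_rdiv_closed)
  consider "k < n" | "n \<le> k" "m + n \<noteq> k" | "m + n = k" by linarith
  then show ?thesis
  proof cases
    case 1
    have "X \<preceq>\<^bsub>K\<^esub> \<one>\<^bsub>K\<^esub>" using K_integral assms(1) .
    with 1 show ?thesis unfolding X Y Z le(1)[unfolded X Y Z]
      by (simp add: K_rdiv_eq K_mult_eq K_le_iff)
  next
    case 2
    then show ?thesis unfolding le unfolding X Y Z
      by (auto simp: K_rdiv_eq K_mult_eq K_le_iff)
  next
    case 3
    have res: "x ((lam ^^ n) i) \<otimes> y i \<preceq> z i \<longleftrightarrow> x ((lam ^^ n) i) \<preceq> z i \<sslash> y i" if "i \<in> I k" for i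
      using that X Y Z 3 K_index_add[of i m n] by (intro rdiv_residuated) (auto simp: family_closed)
    have dom: "i \<in> I n" "(lam ^^ n) i \<in> I m" if "i \<in> I k" for i
      using that 3 K_index_add[of i m n] by simp_all
    let ?q = "\<lambda>j. if j \<in> (lam ^^ n) ` I k
      then z (K_lam_inv I0 I1 lam n j) \<sslash> y (K_lam_inv I0 I1 lam n j) else \<one>"
    have "X \<preceq>\<^bsub>K\<^esub> Z \<sslash>\<^bsub>K\<^esub> Y \<longleftrightarrow> (\<forall>j\<in>I m. x j \<preceq> ?q j)"
      unfolding le unfolding X Y Z using 3 by (auto simp: K_rdiv_eq K_le_iff)
    also have "\<dots> \<longleftrightarrow> (\<forall>j\<in>(lam ^^ n) ` I k. x j \<preceq> ?q j)"
      using X dom by (auto simp: family_closed intro!: integral)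
    also have "\<dots> \<longleftrightarrow> (\<forall>i\<in>I k. x ((lam ^^ n) i) \<preceq> z i \<sslash> y i)"
      using dom by (simp add: K_lam_inv_lam_pow)
    also have "\<dots> \<longleftrightarrow> (\<forall>i\<in>I k. x ((lam ^^ n) i) \<otimes> y i \<preceq> z i)"
      using res by blast
    also have "\<dots> \<longleftrightarrow> X \<otimes>\<^bsub>K\<^esub> Y \<preceq>\<^bsub>K\<^esub> Z"
      unfolding le unfolding X Y Z using 3 by (auto simp: K_mult_eq K_le_iff)
    finally show ?thesis by (rule sym)
  qed
qed

lemma integral_residuated_lattice_K: "integral_residuated_lattice K"
proof -
  interpret K: monoid K by (rule monoid_K)
  interpret L: lattice L by (rule lattice_K_order)
  have ops: "wedge K = Lattice.meet L" "vee K = Lattice.join L"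
    by (simp_all add: K_algebra_def)
  note closed = L.meet_closed L.join_closed
  note assoc = L.weak_meet_assoc L.weak_join_assoc
  show ?thesis
  proof unfold_locales
    fix X Y Z assume "X \<in> carrier K" "Y \<in> carrier K" "Z \<in> carrier K"
    then show "X \<otimes>\<^bsub>K\<^esub> Y \<preceq>\<^bsub>K\<^esub> Z \<longleftrightarrow> Y \<preceq>\<^bsub>K\<^esub> X \<setminus>\<^bsub>K\<^esub> Z"
      and "X \<otimes>\<^bsub>K\<^esub> Y \<preceq>\<^bsub>K\<^esub> Z \<longleftrightarrow> X \<preceq>\<^bsub>K\<^esub> Z \<sslash>\<^bsub>K\<^esub> Y"
      by (rule K_ldiv_residuated, rule K_rdiv_residuated)
  qed (use closed assoc L.meet_join_absorb L.join_meet_absorb in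
      \<open>simp_all add: ops Lattice.meet_comm[of L] Lattice.join_comm[of L] K_ldiv_closed K_rdiv_closed
        K_integral\<close>)
qed

end

theorem theorem3p1:
  fixes G :: "('a, 'b) residuated_lattice_scheme"
    and I0 I1 :: "'i set"
    and lam :: "'i \<Rightarrow> 'i"
  assumes "integral_residuated_lattice G"
    and "I1 \<subseteq> I0"
    and "lam \<in> I1 \<rightarrow> I0"
    and "inj_on lam I1"
  shows "integral_residuated_lattice (K_algebra G I0 I1 lam)"
  by (rule K_construction.integral_residuated_lattice_K)
    (use assms in \<open>simp add: K_construction_def K_construction_axioms_def\<close>)

end
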